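(* Let $\theta\in(0,1)$ and let $(\Sigma,\sigma)$ be the one-sided countable full shift equipped with the metric $d_1(\underline{x},\underline{y})=\sum_{n\ge 0}\theta^n\left|\frac1{x_n}-\frac1{y_n}\right|$. Let $\phi:\Sigma\to\mathbb{R}$ be a potential such that, for some $\kappa>1$, $\phi|_{[n]}\le-\kappa\log(n+1)$ for every $n\in\mathbb{N}$, and suppose that $\phi$ admits a Gibbs measure $\mu$. For $\delta\in(0,1)$ let $\mathcal{U}_\delta$ be the finite open cover of $\Sigma$ defined in the context. Then there exist constants $0<c<1<C<\infty$ such that for every $\delta\in(0,1)$ and every $U\in\mathcal{U}_\delta$, $$\frac{c}{\mu(U)}\le\mathbb{E}_\mu(\tau_U)\le\frac{C}{\mu(U)}.$$
   Context: Here $\mathbb{N}=\{1,2,\dots\}$, $\mathbb{N}_0=\mathbb{N}\cup\{0\}$. The one-sided countable full shift is $\Sigma=\mathbb{N}^{\mathbb{N}_0}$, with elements $\underline{x}=(x_0,x_1,\dots)$, and shift map $\sigma(x_0,x_1,x_2,\dots)=(x_1,x_2,\dots)$. For $y_0,\dots,y_{n-1}\in\mathbb{N}$ the $n$-cylinder is $[y_0,\dots,y_{n-1}]=\{\underline{x}\in\Sigma:x_0=y_0,\dots,x_{n-1}=y_{n-1}\}$; in particular $[n]=\{\underline{x}:x_0=n\}$. Gibbs measure: a $\sigma$-invariant Borel probability measure $\mu$ on $\Sigma$ is a Gibbs measure for $\phi$ if there are constants $K>1$ and $P\in\mathbb{R}$ such that for every $n\ge1$, every $n$-cylinder $Z_n$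 and every $\underline{x}\in Z_n$, $K^{-1}\le\mu(Z_n)/e^{S_n\phi(\underline{x})-nP}\le K$, where $S_n\phi(\underline{x})=\sum_{i=0}^{n-1}\phi(\sigma^i(\underline{x}))$. First hitting time: for $U\subset\Sigma$, $\tau_U(\underline{x})=\inf\{n\ge1:\sigma^n(\underline{x})\in U\}\in\mathbb{N}\cup\{\infty\}$, and $\mathbb{E}_\mu(\tau_U)=\int\tau_U\,d\mu$. The cover $\mathcal{U}_\delta$: let $N$ be the least natural number with $\frac1N\le\delta$ and let $N_s=\min\left\{N-1,\left\lfloor\frac{1+\sqrt{1+4/\delta}}{2}\right\rfloor\right\}$. Let $\mathcal{V}_\delta$ be the finite partition of $\mathbb{N}$ consisting of: the infinite set $\{N,N+1,\dots\}$; the singletons $\{n\}$ for $1\le n\le N_s$; and, for $j=1,2,\dots$, the nonempty sets among $\{n\in\mathbb{N}:n>N_s,\ \lceil N/(j+1)\rceil\le n\le\lceil N/j\rceil-1\}$. Let $V_1,\dots,V_{K_\delta}$ enumerate the elements of $\mathcal{V}_\delta$, and let $k=\left\lceil\frac{\log(\delta(1-\theta))}{\log\theta}\right\rceil$. For $1\le i_0,\dots,i_{k-1}\le K_\delta$ put $$(i_0,\dots,i_{k-1})_{\mathcal{V}_\delta}=\{\underline{x}\in\Sigma:x_0\in V_{i_0},\dots,x_{k-1}\in V_{i_{k-1}}\},$$ and let $\mathcal{U}_\delta$ be the collection of all these sets. *)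

theory Defs
  imports "HOL-Probability.Probability_Measure" "HOL-Analysis.Abstract_Metric_Spaces"
begin

section \<open>The one-sided countable full shift\<close>

text \<open>The alphabet is \<open>{1, 2, \<dots>}\<close>, so the shift space is a proper subset of the type
  \<^typ>\<open>nat \<Rightarrow> nat\<close>; the values of a potential outside it are irrelevant.\<close>

definition full_shift :: "(nat \<Rightarrow> nat) set" where
  "full_shift = {x. \<forall>n. x n \<ge> 1}"

definition shift :: "(nat \<Rightarrow> nat) \<Rightarrow> (nat \<Rightarrow> nat)" where
  "shift x = (\<lambda>n. x (Suc n))"

definition d1 :: "real \<Rightarrow> (nat \<Rightarrow> nat) \<Rightarrow> (nat \<Rightarrow> nat) \<Rightarrow> real" where
  "d1 \<theta> x y = (\<Sum>n. \<theta> ^ n * \<bar>1 / real (x n) - 1 / real (y n)\<bar>)"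

definition cylinder :: "nat list \<Rightarrow> (nat \<Rightarrow> nat) set" where
  "cylinder ys = {x \<in> full_shift. \<forall>i < length ys. x i = ys ! i}"

definition shift_borel :: "real \<Rightarrow> (nat \<Rightarrow> nat) measure" where
  "shift_borel \<theta> = sigma full_shift {U. openin (Metric_space.mtopology full_shift (d1 \<theta>)) U}"

section \<open>Gibbs measures\<close>

definition birkhoff_sum :: "((nat \<Rightarrow> nat) \<Rightarrow> real) \<Rightarrow> nat \<Rightarrow> (nat \<Rightarrow> nat) \<Rightarrow> real" where
  "birkhoff_sum \<phi> n x = (\<Sum>i<n. \<phi> ((shift ^^ i) x))"

definition shift_invariant :: "(nat \<Rightarrow> nat) measure \<Rightarrow> bool" where
  "shift_invariant \<mu> \<longleftrightarrow>
     (\<forall>A \<in> sets \<mu>. emeasure \<mu> (shift -` A \<inter> space \<mu>) = emeasure \<mu> A)"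

definition gibbs_measure ::
    "real \<Rightarrow> ((nat \<Rightarrow> nat) \<Rightarrow> real) \<Rightarrow> (nat \<Rightarrow> nat) measure \<Rightarrow> bool" where
  "gibbs_measure \<theta> \<phi> \<mu> \<longleftrightarrow>
     prob_space \<mu> \<and> sets \<mu> = sets (shift_borel \<theta>) \<and> shift_invariant \<mu> \<and>
     (\<exists>K P :: real. K > 1 \<and>
        (\<forall>n \<ge> 1. \<forall>ys. length ys = n \<and> set ys \<subseteq> {1..} \<longrightarrow>
           (\<forall>x \<in> cylinder ys.
              1 / K \<le> measure \<mu> (cylinder ys) / exp (birkhoff_sum \<phi> n x - real n * P) \<and>
              measure \<mu> (cylinder ys) / exp (birkhoff_sum \<phi> n x - real n * P) \<le> K)))"

section \<open>Hitting times\<close>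

text \<open>The infimum over the empty set is \<open>\<infinity>\<close> in \<^typ>\<open>enat\<close>.\<close>

definition hitting_time :: "(nat \<Rightarrow> nat) set \<Rightarrow> (nat \<Rightarrow> nat) \<Rightarrow> enat" where
  "hitting_time U x = Inf (enat ` {n. n \<ge> 1 \<and> (shift ^^ n) x \<in> U})"

definition expected_hitting_time :: "(nat \<Rightarrow> nat) measure \<Rightarrow> (nat \<Rightarrow> nat) set \<Rightarrow> ennreal" where
  "expected_hitting_time \<mu> U = (\<integral>\<^sup>+ x. ennreal_of_enat (hitting_time U x) \<partial>\<mu>)"

section \<open>The cover associated with a scale\<close>

definition cover_N :: "real \<Rightarrow> nat" where
  "cover_N \<delta> = (LEAST N. N \<ge> 1 \<and> 1 / real N \<le> \<delta>)"

definition cover_Ns :: "real \<Rightarrow> nat" where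
  "cover_Ns \<delta> = min (cover_N \<delta> - 1) (nat \<lfloor>(1 + sqrt (1 + 4 / \<delta>)) / 2\<rfloor>)"

definition cover_block :: "real \<Rightarrow> nat \<Rightarrow> nat set" where
  "cover_block \<delta> j = {n. n > cover_Ns \<delta> \<and>
     \<lceil>real (cover_N \<delta>) / real (j + 1)\<rceil> \<le> int n \<and> int n \<le> \<lceil>real (cover_N \<delta>) / real j\<rceil> - 1}"

definition alphabet_partition :: "real \<Rightarrow> nat set set" where
  "alphabet_partition \<delta> =
     {{cover_N \<delta>..}} \<union> {{n} | n. 1 \<le> n \<and> n \<le> cover_Ns \<delta>} \<union>
     {cover_block \<delta> j | j. j \<ge> 1 \<and> cover_block \<delta> j \<noteq> {}}"

definition cover_k :: "real \<Rightarrow> real \<Rightarrow> nat" where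
  "cover_k \<theta> \<delta> = nat \<lceil>ln (\<delta> * (1 - \<theta>)) / ln \<theta>\<rceil>"

text \<open>The words \<open>Vs\<close> are the tuples \<open>(V\<^bsub>i\<^sub>0\<^esub>, \<dots>)\<close> themselves, so that no enumeration of the
  partition is needed.\<close>

definition shift_cover :: "real \<Rightarrow> real \<Rightarrow> (nat \<Rightarrow> nat) set set" where
  "shift_cover \<theta> \<delta> =
     {{x \<in> full_shift. \<forall>m < cover_k \<theta> \<delta>. x m \<in> Vs ! m} | Vs.
        length Vs = cover_k \<theta> \<delta> \<and> set Vs \<subseteq> alphabet_partition \<delta>}"

section \<open>Well-definedness of the metric and of the cover\<close>

lemma d1_summable:
  assumes "0 < \<theta>" "\<theta> < 1"
  shows "summable (\<lambda>n. \<theta> ^ n * \<bar>1 / real (x n) - 1 / real (y n)\<bar>)"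
proof (rule summable_comparison_test'[of "\<lambda>n. \<theta> ^ n" 0])
  show "summable (\<lambda>n. \<theta> ^ n)" using assms by (simp add: summable_geometric)
  fix n
  have "0 \<le> 1 / real k \<and> 1 / real k \<le> 1" for k :: nat by (cases k) auto
  from this[of "x n"] this[of "y n"] have "\<bar>1 / real (x n) - 1 / real (y n)\<bar> \<le> 1" by linarith
  then show "norm (\<theta> ^ n * \<bar>1 / real (x n) - 1 / real (y n)\<bar>) \<le> \<theta> ^ n"
    using assms by (simp add: abs_mult mult_left_le)
qed

lemma d1_coord:
  assumes "0 < \<theta>" "\<theta> < 1"
  shows "\<theta> ^ n * \<bar>1 / real (x n) - 1 / real (y n)\<bar> \<le> d1 \<theta> x y"
  unfolding d1_def
  using sum_le_suminf[OF d1_summable[OF assms], of "{n}" x y] assms by simp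

lemma Metric_space_d1:
  assumes "0 < \<theta>" "\<theta> < 1"
  shows "Metric_space full_shift (d1 \<theta>)"
proof
  fix x y z :: "nat \<Rightarrow> nat"
  show "0 \<le> d1 \<theta> x y"
    unfolding d1_def by (rule suminf_nonneg[OF d1_summable[OF assms]]) (use assms in auto)
  show "d1 \<theta> x y = d1 \<theta> y x"
    unfolding d1_def by (simp add: abs_minus_commute)
  show "d1 \<theta> x y = 0 \<longleftrightarrow> x = y" if "x \<in> full_shift" "y \<in> full_shift"
  proof
    assume 0: "d1 \<theta> x y = 0"
    show "x = y"
    proof
      fix n
      have "\<theta> ^ n * \<bar>1 / real (x n) - 1 / real (y n)\<bar> \<le> 0"
        using d1_coord[OF assms, of n x y] 0 by simp
      then have "\<bar>1 / real (x n) - 1 / real (y n)\<bar> \<le> 0"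
        using mult_pos_pos[of "\<theta> ^ n"] assms by (meson linorder_not_le zero_less_power)
      then show "x n = y n" by (simp add: inverse_eq_divide[symmetric])
    qed
  qed (simp add: d1_def)
  have "d1 \<theta> x z \<le> (\<Sum>n. \<theta> ^ n * \<bar>1 / real (x n) - 1 / real (y n)\<bar> +
      \<theta> ^ n * \<bar>1 / real (y n) - 1 / real (z n)\<bar>)"
    unfolding d1_def
  proof (rule suminf_le)
    fix n
    have "\<theta> ^ n * \<bar>1 / real (x n) - 1 / real (z n)\<bar> \<le>
        \<theta> ^ n * (\<bar>1 / real (x n) - 1 / real (y n)\<bar> + \<bar>1 / real (y n) - 1 / real (z n)\<bar>)"
      by (rule mult_left_mono) (use assms in auto)
    then show "\<theta> ^ n * \<bar>1 / real (x n) - 1 / real (z n)\<bar> \<le>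
        \<theta> ^ n * \<bar>1 / real (x n) - 1 / real (y n)\<bar> + \<theta> ^ n * \<bar>1 / real (y n) - 1 / real (z n)\<bar>"
      by (simp add: distrib_left)
  qed (intro d1_summable[OF assms] summable_add)+
  then show "d1 \<theta> x z \<le> d1 \<theta> x y + d1 \<theta> y z"
    unfolding d1_def by (simp add: suminf_add[OF d1_summable[OF assms] d1_summable[OF assms]])
qed

lemma openin_coord:
  assumes "0 < \<theta>" "\<theta> < 1"
  shows "openin (Metric_space.mtopology full_shift (d1 \<theta>)) {x \<in> full_shift. x m \<in> V}"
proof -
  interpret Metric_space full_shift "d1 \<theta>" by (rule Metric_space_d1[OF assms])
  show ?thesis
    unfolding openin_mtopology
  proof (intro conjI allI impI)
    fix x assume x: "x \<in> {x \<in> full_shift. x m \<in> V}"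
    define a where "a = x m"
    have a: "a \<ge> 1" using x by (auto simp: full_shift_def a_def)
    define r where "r = \<theta> ^ m / (real a * (real a + 1))"
    have "r > 0" using a assms by (simp add: r_def)
    moreover have "mball x r \<subseteq> {x \<in> full_shift. x m \<in> V}"
    proof
      fix y assume "y \<in> mball x r"
      then have y: "y \<in> full_shift" "d1 \<theta> x y < r" by auto
      define b where "b = y m"
      have b: "b \<ge> 1" using y by (auto simp: full_shift_def b_def)
      have "\<theta> ^ m * \<bar>1 / real a - 1 / real b\<bar> < r"
        using d1_coord[OF assms, of m x y] y by (simp add: a_def b_def)
      then have lt: "\<bar>1 / real a - 1 / real b\<bar> < 1 / (real a * (real a + 1))"
        using assms mult_less_cancel_left_pos[of "\<theta> ^ m" _ "1 / (real a * (real a + 1))"]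
        unfolding r_def by (simp only: times_divide_eq_right mult_1_right zero_less_power)
      have gap: "1 / real a - 1 / (real a + 1) = 1 / (real a * (real a + 1))"
        using a by (simp add: field_simps)
      have "a = b"
      proof (rule ccontr)
        assume "a \<noteq> b"
        then consider "b \<ge> a + 1" | "b + 1 \<le> a" by linarith
        then show False
        proof cases
          case 1
          then have "1 / real b \<le> 1 / (real a + 1)" using a by (intro divide_left_mono) auto
          then show False using lt gap by linarith
        next
          case 2
          have "1 / real b - 1 / real a = (real a - real b) / (real a * real b)"
            using a b by (simp add: field_simps)
          also have "\<dots> \<ge> 1 / (real a * real b)" using 2 a b by (intro divide_right_mono) auto
          finally have "1 / real b - 1 / real a \<ge> 1 / (real a * real b)" .
          moreover have "1 / (real a * real b) \<ge> 1 / (real a * (real a + 1))"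
            using 2 a b by (intro divide_left_mono mult_left_mono) auto
          ultimately show False using lt by linarith
        qed
      qed
      then show "y \<in> {x \<in> full_shift. x m \<in> V}" using x y by (auto simp: a_def b_def)
    qed
    ultimately show "\<exists>r>0. mball x r \<subseteq> {x \<in> full_shift. x m \<in> V}" by blast
  qed auto
qed

lemma shift_cover_open:
  assumes "0 < \<theta>" "\<theta> < 1" "U \<in> shift_cover \<theta> \<delta>"
  shows "openin (Metric_space.mtopology full_shift (d1 \<theta>)) U"
proof -
  interpret Metric_space full_shift "d1 \<theta>" by (rule Metric_space_d1[OF assms(1,2)])
  obtain Vs where U: "U = {x \<in> full_shift. \<forall>m < cover_k \<theta> \<delta>. x m \<in> Vs ! m}"
    using assms(3) by (auto simp: shift_cover_def)
  have "U = topspace mtopology \<inter>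
      (\<Inter>m \<in> {..<cover_k \<theta> \<delta>}. {x \<in> full_shift. x m \<in> Vs ! m})" if "cover_k \<theta> \<delta> > 0"
    using that by (auto simp: U)
  moreover have "U = topspace mtopology" if "cover_k \<theta> \<delta> = 0"
    using that by (auto simp: U)
  moreover have "openin mtopology (\<Inter>m \<in> {..<cover_k \<theta> \<delta>}. {x \<in> full_shift. x m \<in> Vs ! m})"
    if "cover_k \<theta> \<delta> > 0"
    using that openin_coord[OF assms(1,2)] by (intro openin_INT2) auto
  ultimately show ?thesis
    by (cases "cover_k \<theta> \<delta> = 0") (auto intro: openin_Int)
qed

lemma cover_N_ge_2:
  assumes "0 < \<delta>" "\<delta> < 1"
  shows "cover_N \<delta> \<ge> 2" "1 / real (cover_N \<delta>) \<le> \<delta>"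
proof -
  obtain n :: nat where n: "1 / \<delta> < real n" using reals_Archimedean2 by blast
  moreover have "0 < 1 / \<delta>" using assms by simp
  ultimately have "real n > 0" by linarith
  then have "n \<ge> 1" "1 / real n \<le> \<delta>"
    using assms n by (simp_all add: field_simps)
  then have *: "cover_N \<delta> \<ge> 1 \<and> 1 / real (cover_N \<delta>) \<le> \<delta>"
    unfolding cover_N_def by (intro LeastI[of "\<lambda>N. N \<ge> 1 \<and> 1 / real N \<le> \<delta>" n]) auto
  then show "1 / real (cover_N \<delta>) \<le> \<delta>" by blast
  have "cover_N \<delta> \<noteq> 1" using * assms by auto
  then show "cover_N \<delta> \<ge> 2" using * by linarith
qed

lemma cover_block_cover:
  assumes "cover_Ns \<delta> < n" "n < cover_N \<delta>"
  shows "\<exists>j\<ge>1. n \<in> cover_block \<delta> j"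
proof -
  define N where "N = cover_N \<delta>"
  define J where "J = (LEAST j. real N / real (j + 1) \<le> real n)"
  have n: "n \<ge> 1" "n < N" using assms by (auto simp: N_def)
  have "real N / real (N + 1) \<le> 1" by simp
  also have "\<dots> \<le> real n" using n by simp
  finally have "real N / real (N + 1) \<le> real n" .
  then have J: "real N / real (J + 1) \<le> real n"
    unfolding J_def by (rule LeastI)
  have "J \<noteq> 0" using J n by (intro notI) simp
  then have J1: "J \<ge> 1" by simp
  have "\<not> real N / real ((J - 1) + 1) \<le> real n"
    unfolding J_def by (rule not_less_Least) (use J1 in \<open>simp add: J_def\<close>)
  then have "real n < real N / real J" using J1 by simp
  then have "int n < \<lceil>real N / real J\<rceil>" by (simp add: less_ceiling_iff)
  moreover have "\<lceil>real N / real (J + 1)\<rceil> \<le> int n" using J by (simp add: ceiling_le_iff)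
  ultimately have "n \<in> cover_block \<delta> J" using assms by (simp add: cover_block_def N_def)
  then show ?thesis using J1 by blast
qed

lemma alphabet_partition_Union:
  assumes "0 < \<delta>" "\<delta> < 1"
  shows "\<Union>(alphabet_partition \<delta>) = {1..}"
proof
  show "\<Union>(alphabet_partition \<delta>) \<subseteq> {1..}"
    using cover_N_ge_2[OF assms] by (auto simp: alphabet_partition_def cover_block_def)
  show "{1..} \<subseteq> \<Union>(alphabet_partition \<delta>)"
  proof
    fix n :: nat assume "n \<in> {1..}"
    then consider "n \<le> cover_Ns \<delta>" "n \<ge> 1" | "n \<ge> cover_N \<delta>" | "cover_Ns \<delta> < n" "n < cover_N \<delta>"
      by force
    then show "n \<in> \<Union>(alphabet_partition \<delta>)"
      using cover_block_cover[of \<delta> n] unfolding alphabet_partition_def by cases blast+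
  qed
qed

lemma alphabet_partition_disjoint: "disjoint (alphabet_partition \<delta>)"
proof -
  have less: "\<lceil>real (cover_N \<delta>) / real j\<rceil> \<le> \<lceil>real (cover_N \<delta>) / real (i + 1)\<rceil>"
    if "i < j" for i j :: nat
    using that by (intro ceiling_mono divide_left_mono) auto
  have blocks: "i = j" if "n \<in> cover_block \<delta> i" "n \<in> cover_block \<delta> j" for i j n
    using that less[of i j] less[of j i] unfolding cover_block_def
    by (cases i j rule: linorder_cases) auto
  have tail: "n < cover_N \<delta>" if "n \<in> cover_block \<delta> j" "j \<ge> 1" for n j
  proof -
    have "\<lceil>real (cover_N \<delta>) / real j\<rceil> \<le> \<lceil>real (cover_N \<delta>)\<rceil>"
      using that(2) by (intro ceiling_mono) (simp add: divide_le_eq mult_le_cancel_left1)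
    then show ?thesis using that(1) by (simp add: cover_block_def)
  qed
  have single: "n > cover_Ns \<delta>" if "n \<in> cover_block \<delta> j" for n j
    using that by (simp add: cover_block_def)
  have N: "n < cover_N \<delta>" if "1 \<le> n" "n \<le> cover_Ns \<delta>" for n
    using that unfolding cover_Ns_def by linarith
  show ?thesis
  proof (rule disjointI)
    fix A B assume AB: "A \<in> alphabet_partition \<delta>" "B \<in> alphabet_partition \<delta>" "A \<noteq> B"
    show "A \<inter> B = {}"
    proof (rule ccontr)
      assume "A \<inter> B \<noteq> {}"
      then obtain n where n: "n \<in> A" "n \<in> B" by blast
      consider "A = {cover_N \<delta>..}" | "1 \<le> n" "n \<le> cover_Ns \<delta>" "A = {n}"
        | j where "j \<ge> 1" "A = cover_block \<delta> j"
        using AB(1) n(1) unfolding alphabet_partition_def by auto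
      note A = this
      consider "B = {cover_N \<delta>..}" | "1 \<le> n" "n \<le> cover_Ns \<delta>" "B = {n}"
        | j where "j \<ge> 1" "B = cover_block \<delta> j"
        using AB(2) n(2) unfolding alphabet_partition_def by auto
      note B = this
      have excl: "\<not> (n \<ge> cover_N \<delta> \<and> 1 \<le> n \<and> n \<le> cover_Ns \<delta>)"
        "\<not> (n \<ge> cover_N \<delta> \<and> n \<in> cover_block \<delta> j \<and> j \<ge> 1)"
        "\<not> (n \<le> cover_Ns \<delta> \<and> n \<in> cover_block \<delta> j)" for j
        using N[of n] tail[of n j] single[of n j] by auto
      show False
        using A
      proof cases
        case 1
        then show ?thesis using B n AB(3) excl by cases auto
      next
        case 2
        then show ?thesis using B n AB(3) excl by cases auto
      next
        case (3 i)
        from B show ?thesis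
        proof cases
          case 1
          then show ?thesis using 3 n excl by auto
        next
          case 2
          then show ?thesis using 3 n excl by auto
        next
          case (3 j)
          then show ?thesis using n AB(3) blocks[of n i j] \<open>A = cover_block \<delta> i\<close> by auto
        qed
      qed
    qed
  qed
qed

lemma alphabet_partition_finite:
  "finite (alphabet_partition \<delta>)"
proof -
  have "cover_block \<delta> j \<subseteq> {..cover_N \<delta>}" if "j \<ge> 1" for j
  proof
    fix n assume "n \<in> cover_block \<delta> j"
    moreover have "\<lceil>real (cover_N \<delta>) / real j\<rceil> \<le> \<lceil>real (cover_N \<delta>)\<rceil>"
      using that by (intro ceiling_mono) (simp add: divide_le_eq mult_le_cancel_left1)
    ultimately show "n \<in> {..cover_N \<delta>}" by (simp add: cover_block_def)
  qed
  then have "{cover_block \<delta> j | j. j \<ge> 1 \<and> cover_block \<delta> j \<noteq> {}} \<subseteq> Pow {..cover_N \<delta>}" by blast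
  then have "finite {cover_block \<delta> j | j. j \<ge> 1 \<and> cover_block \<delta> j \<noteq> {}}"
    by (rule finite_subset) simp
  moreover have "finite {{n} | n. 1 \<le> n \<and> n \<le> cover_Ns \<delta>}" by simp
  ultimately show ?thesis unfolding alphabet_partition_def by simp
qed

lemma shift_cover_finite: "finite (shift_cover \<theta> \<delta>)"
proof -
  have "shift_cover \<theta> \<delta> = (\<lambda>Vs. {x \<in> full_shift. \<forall>m < cover_k \<theta> \<delta>. x m \<in> Vs ! m}) `
      {Vs. set Vs \<subseteq> alphabet_partition \<delta> \<and> length Vs = cover_k \<theta> \<delta>}"
    unfolding shift_cover_def by auto
  then show ?thesis using finite_lists_length_eq[OF alphabet_partition_finite] by simp
qed

lemma shift_cover_Union:
  assumes "0 < \<delta>" "\<delta> < 1"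
  shows "\<Union>(shift_cover \<theta> \<delta>) = full_shift"
proof
  show "\<Union>(shift_cover \<theta> \<delta>) \<subseteq> full_shift" by (auto simp: shift_cover_def)
  show "full_shift \<subseteq> \<Union>(shift_cover \<theta> \<delta>)"
  proof
    fix x assume x: "x \<in> full_shift"
    have "\<exists>V. V \<in> alphabet_partition \<delta> \<and> x m \<in> V" for m
      using x alphabet_partition_Union[OF assms] unfolding full_shift_def by blast
    then obtain V where V: "\<And>m. V m \<in> alphabet_partition \<delta> \<and> x m \<in> V m" by metis
    define Vs where "Vs = map V [0..<cover_k \<theta> \<delta>]"
    have "length Vs = cover_k \<theta> \<delta>" "set Vs \<subseteq> alphabet_partition \<delta>"
      "x \<in> {x \<in> full_shift. \<forall>m < cover_k \<theta> \<delta>. x m \<in> Vs ! m}"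
      using V x by (auto simp: Vs_def)
    then show "x \<in> \<Union>(shift_cover \<theta> \<delta>)" unfolding shift_cover_def by blast
  qed
qed

end

theory Submission
  imports Defs
begin

text \<open>Why the hitting time has order \<open>1 / \<mu>(U)\<close>, uniformly in the scale. By the Gibbs property
  \<open>\<mu>\<close> is quasi-Bernoulli: \<open>\<mu>[vw]\<close> agrees with \<open>\<mu>[v] \<mu>[w]\<close> up to a constant factor \<open>D\<close>
  (\<open>gibbs_measure_imp_quasi_bernoulli\<close>). Summing over words, the same holds for
  \<open>\<mu>(A \<inter> \<sigma>\<^sup>-\<^sup>m B)\<close> whenever \<open>A\<close> is decided by the first \<open>m\<close> letters and \<open>B\<close> by finitely many
  (\<open>prob_joint_upper\<close>, \<open>prob_joint_lower\<close>). Hence whatever happened before time \<open>m\<close>, an event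
  \<open>B\<close> starting at time \<open>m\<close> is avoided with conditional probability at most \<open>1 - \<mu>(B) / D\<close>
  (\<open>prob_miss\<close>).

  Write \<open>U = {x. x\<^sub>m \<in> V\<^sub>m for m < k}\<close> and \<open>u = \<mu>(U)\<close>. The cover enters through the fact that
  \<open>{1}\<close> is an element of the partition of the alphabet at every scale, so each \<open>V\<^sub>m\<close> misses the
  letter \<open>1\<close> or the letter \<open>2\<close>. As both have positive measure, each further constraint
  \<open>x\<^sub>m \<in> V\<^sub>m\<close> costs a factor \<open>\<rho> < 1\<close> independent of the scale: a constraint on \<open>k\<close> letters has
  measure at most \<open>\<rho>\<^sup>k\<close> (\<open>prob_block_cylinder_le\<close>).

  Lower bound: \<open>\<mu>(\<tau>\<^sub>U \<le> n) \<le> n u\<close> by invariance, so \<open>\<tau>\<^sub>U\<close> exceeds every \<open>n < 1 / (2u)\<close> with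
  probability at least \<open>1/2\<close>, and the expectation is at least \<open>1 / (4u)\<close>.

  Upper bound: let \<open>T\<close> be about \<open>1 / u\<close>. The expected number of visits to \<open>U\<close> during
  \<open>{1..T}\<close> is at least \<open>1\<close>. Its second moment is bounded: two visits at distance \<open>g \<ge> k\<close>
  are independent up to the factor \<open>D\<close>, and two visits at distance \<open>g < k\<close> constrain \<open>g\<close> new letters after
  the first visit, so that the joint probability is at most \<open>D u \<rho>\<^sup>g\<close>, which is summable
  in \<open>g\<close> (\<open>prob_return_le\<close>). By
  the second moment method \<open>U\<close> is visited during \<open>{1..T}\<close> with probability at least a constant
  (\<open>prob_hits_ge\<close>). This window is decided by \<open>T + k\<close> letters, so after each further block of that
  length the probability of no visit shrinks by a constant factor (\<open>prob_no_hits_le\<close>), and the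
  expectation is at most a constant times \<open>T + k\<close>. Finally \<open>k u \<le> k \<rho>\<^sup>k\<close> is bounded, so
  \<open>T + k\<close> has order \<open>1 / u\<close> (\<open>expected_hitting_time_block_cylinder_upper\<close>). Sampling the
  orbit only at multiples of \<open>k\<close> would lose this uniformity, since it costs a factor \<open>k\<close>.\<close>

section \<open>Events decided by finitely many letters\<close>

definition at_time :: "nat \<Rightarrow> (nat \<Rightarrow> nat) set \<Rightarrow> (nat \<Rightarrow> nat) set" where
  "at_time m B = {x \<in> full_shift. (shift ^^ m) x \<in> B}"

text \<open>The unions of \<open>n\<close>-cylinders, described without a set of words.\<close>

definition depends :: "nat \<Rightarrow> (nat \<Rightarrow> nat) set \<Rightarrow> bool" where
  "depends n A \<longleftrightarrow> A \<subseteq> full_shift \<and>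
     (\<forall>x \<in> A. \<forall>y \<in> full_shift. (\<forall>i<n. x i = y i) \<longrightarrow> y \<in> A)"

text \<open>The shape of the elements of the cover: letters are only constrained up to their class in a
  partition of the alphabet.\<close>

definition block_cylinder :: "nat \<Rightarrow> (nat \<Rightarrow> nat set) \<Rightarrow> (nat \<Rightarrow> nat) set" where
  "block_cylinder k V = {x \<in> full_shift. \<forall>m<k. x m \<in> V m}"

lemma funpow_shift: "(shift ^^ m) x = (\<lambda>i. x (i + m))"
  by (induction m arbitrary: x) (auto simp: shift_def funpow_swap1)

lemma full_shift_funpow: "x \<in> full_shift \<Longrightarrow> (shift ^^ m) x \<in> full_shift"
  by (auto simp: full_shift_def funpow_shift)

lemma dependsD:
  "depends n A \<Longrightarrow> x \<in> A \<Longrightarrow> y \<in> full_shift \<Longrightarrow> (\<And>i. i < n \<Longrightarrow> x i = y i) \<Longrightarrow> y \<in> A"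
  unfolding depends_def by blast

lemma depends_mono: "depends m A \<Longrightarrow> m \<le> n \<Longrightarrow> depends n A"
  unfolding depends_def by (meson less_le_trans)

lemma depends_full_shift: "depends n full_shift"
  by (auto simp: depends_def)

lemma depends_Int: "depends n A \<Longrightarrow> depends n B \<Longrightarrow> depends n (A \<inter> B)"
  unfolding depends_def by blast

lemma depends_Diff: "depends n A \<Longrightarrow> depends n (full_shift - A)"
  unfolding depends_def by (metis DiffD1 DiffD2 DiffI Diff_subset)

lemma depends_UN: "(\<And>i. i \<in> I \<Longrightarrow> depends n (A i)) \<Longrightarrow> depends n (\<Union>i\<in>I. A i)"
  unfolding depends_def by blast

lemma depends_at_time: "depends n B \<Longrightarrow> depends (m + n) (at_time m B)"
  unfolding depends_def at_time_def
  by (auto simp: funpow_shift full_shift_def)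

lemma depends_cylinder: "depends (length w) (cylinder w)"
  by (auto simp: depends_def cylinder_def)

lemma depends_block_cylinder: "depends k (block_cylinder k V)"
  by (auto simp: depends_def block_cylinder_def)

lemma at_time_0: "B \<subseteq> full_shift \<Longrightarrow> at_time 0 B = B"
  by (auto simp: at_time_def)

lemma at_time_add: "at_time m (at_time n B) = at_time (m + n) B"
  by (auto simp: at_time_def funpow_shift full_shift_def ac_simps)

lemma cylinder_append: "cylinder (v @ w) = cylinder v \<inter> at_time (length v) (cylinder w)"
proof (intro set_eqI iffI)
  fix x assume x: "x \<in> cylinder (v @ w)"
  have "x i = v ! i" if "i < length v" for i
    using x that unfolding cylinder_def by (auto simp: nth_append dest!: spec[of _ i])
  moreover have "x (i + length v) = w ! i" if "i < length w" for i
    using x that unfolding cylinder_def by (auto simp: nth_append dest!: spec[of _ "i + length v"])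
  ultimately show "x \<in> cylinder v \<inter> at_time (length v) (cylinder w)"
    using x by (auto simp: cylinder_def at_time_def funpow_shift full_shift_def)
next
  fix x assume x: "x \<in> cylinder v \<inter> at_time (length v) (cylinder w)"
  have "x i = (v @ w) ! i" if "i < length (v @ w)" for i
  proof (cases "i < length v")
    case True
    then show ?thesis using x by (auto simp: cylinder_def nth_append)
  next
    case False
    then have "(shift ^^ length v) x (i - length v) = w ! (i - length v)"
      using x that by (auto simp: cylinder_def at_time_def)
    then show ?thesis using False by (simp add: funpow_shift nth_append)
  qed
  then show "x \<in> cylinder (v @ w)" using x by (auto simp: cylinder_def)
qed

lemma depends_eq_UN_cylinders:
  assumes "depends n B"
  shows "B = (\<Union>w \<in> (\<lambda>x. map x [0..<n]) ` B. cylinder w)"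
proof (intro set_eqI iffI)
  fix x assume "x \<in> B"
  then show "x \<in> (\<Union>w \<in> (\<lambda>x. map x [0..<n]) ` B. cylinder w)"
    using assms by (auto simp: cylinder_def depends_def intro!: bexI[of _ x])
next
  fix x assume "x \<in> (\<Union>w \<in> (\<lambda>x. map x [0..<n]) ` B. cylinder w)"
  then show "x \<in> B"
    using assms by (auto simp: cylinder_def intro: dependsD[OF assms])
qed

lemma cylinders_disjoint:
  "disjoint_family_on cylinder {w. length w = n}"
  by (auto simp: disjoint_family_on_def cylinder_def intro!: nth_equalityI)

lemma hitting_time_le_iff:
  "hitting_time U x \<le> enat n \<longleftrightarrow> (\<exists>i\<in>{1..n}. (shift ^^ i) x \<in> U)"
proof
  let ?S = "{n. n \<ge> 1 \<and> (shift ^^ n) x \<in> U}"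
  assume le: "hitting_time U x \<le> enat n"
  have "?S \<noteq> {}"
  proof
    assume empty: "?S = {}"
    have "hitting_time U x = \<infinity>" unfolding hitting_time_def empty by (simp add: Inf_enat_def)
    then show False using le by simp
  qed
  then obtain m where "m \<in> ?S" by blast
  then have "hitting_time U x \<in> enat ` ?S"
    unfolding hitting_time_def by (intro wellorder_InfI[of "enat m"] imageI)
  then show "\<exists>i\<in>{1..n}. (shift ^^ i) x \<in> U" using le by auto
next
  assume "\<exists>i\<in>{1..n}. (shift ^^ i) x \<in> U"
  then obtain i where i: "1 \<le> i" "i \<le> n" "(shift ^^ i) x \<in> U" by auto
  then have "hitting_time U x \<le> enat i"
    unfolding hitting_time_def by (intro Inf_lower) auto
  also have "\<dots> \<le> enat n" using i by simp
  finally show "hitting_time U x \<le> enat n" .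
qed

section \<open>A second moment bound\<close>

text \<open>With \<open>N\<close> the number of the events that occur, \<open>(1 - N / Q)\<^sup>2 \<ge> 0\<close> says
  \<open>2 N / Q - N\<^sup>2 / Q\<^sup>2 \<le> 1\<close>, and the left side vanishes when \<open>N = 0\<close>; so it is at most
  the indicator of the union. Integrating gives the bound, without dividing by the second moment
  as Cauchy--Schwarz would.\<close>

lemma (in prob_space) second_moment_bound:
  assumes fin: "finite I" and E: "\<And>i. i \<in> I \<Longrightarrow> E i \<in> events"
    and Q: "Q > 0" "(\<Sum>i\<in>I. \<Sum>j\<in>I. prob (E i \<inter> E j)) \<le> Q * (\<Sum>i\<in>I. prob (E i))"
  shows "(\<Sum>i\<in>I. prob (E i)) / Q \<le> prob (\<Union>i\<in>I. E i)"
proof -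
  define N where "N x = (\<Sum>i\<in>I. indicator (E i) x :: real)" for x
  have N2: "N x * N x = (\<Sum>i\<in>I. \<Sum>j\<in>I. indicator (E i \<inter> E j) x)" for x
    unfolding N_def by (simp add: sum_product indicator_inter_arith)
  have int1: "integrable M N"
    unfolding N_def using E by (intro Bochner_Integration.integrable_sum integrable_real_indicator)
      (auto simp: less_top[symmetric])
  have int2: "integrable M (\<lambda>x. N x * N x)"
    unfolding N2 using E by (intro Bochner_Integration.integrable_sum integrable_real_indicator)
      (auto simp: less_top[symmetric])
  have U: "(\<Union>i\<in>I. E i) \<in> events" using E fin by auto
  have eN: "expectation N = (\<Sum>i\<in>I. prob (E i))"
    unfolding N_def using E
    by (subst Bochner_Integration.integral_sum) (auto simp: less_top[symmetric] intro!: sum.cong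
       integrable_real_indicator)
  have eN2: "expectation (\<lambda>x. N x * N x) = (\<Sum>i\<in>I. \<Sum>j\<in>I. prob (E i \<inter> E j))"
    unfolding N2 using E
    by (subst Bochner_Integration.integral_sum Bochner_Integration.integrable_sum |
        auto simp: less_top[symmetric] intro!: sum.cong integrable_real_indicator)+
  have pt: "2 / Q * N x - 1 / Q\<^sup>2 * (N x * N x) \<le> indicator (\<Union>i\<in>I. E i) x" for x
  proof (cases "x \<in> (\<Union>i\<in>I. E i)")
    case True
    have "0 \<le> (1 - N x / Q)\<^sup>2" by simp
    then show ?thesis using True by (simp add: power2_eq_square algebra_simps)
  next
    case False
    then have "N x = 0" unfolding N_def by (intro sum.neutral) (auto simp: indicator_def)
    then show ?thesis by simp
  qed
  have "expectation (\<lambda>x. 2 / Q * N x - 1 / Q\<^sup>2 * (N x * N x)) \<le>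
      expectation (indicator (\<Union>i\<in>I. E i))"
    using int1 int2 U pt
    by (intro integral_mono Bochner_Integration.integrable_diff integrable_mult_right
        integrable_real_indicator) (auto simp: less_top[symmetric])
  also have "\<dots> = prob (\<Union>i\<in>I. E i)" using U by simp
  also have "expectation (\<lambda>x. 2 / Q * N x - 1 / Q\<^sup>2 * (N x * N x)) =
      2 / Q * expectation N - 1 / Q\<^sup>2 * expectation (\<lambda>x. N x * N x)"
    using int1 int2 by (subst Bochner_Integration.integral_diff) auto
  also have "\<dots> \<ge> 2 / Q * expectation N - 1 / Q\<^sup>2 * (Q * expectation N)"
    using Q(2) Q(1) by (intro diff_left_mono mult_left_mono) (auto simp: eN eN2)
  finally show ?thesis using Q(1) by (simp add: eN power2_eq_square field_simps)
qed

section \<open>Quasi-Bernoulli measures\<close>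

text \<open>The feature of a Gibbs measure on which the estimates rest: up to a constant factor,
  the measure of a concatenated word is the product of the measures of its parts.\<close>

locale quasi_bernoulli = prob_space \<mu> for \<mu> :: "(nat \<Rightarrow> nat) measure" +
  fixes D :: real
  assumes space_eq: "space \<mu> = full_shift"
    and coordinate_event: "\<And>i V. {x \<in> full_shift. x i \<in> V} \<in> sets \<mu>"
    and invariant: "shift_invariant \<mu>"
    and D_ge_1: "D \<ge> 1"
    and cylinder_pos: "\<And>w. set w \<subseteq> {1..} \<Longrightarrow> measure \<mu> (cylinder w) > 0"
    and concat_upper: "\<And>v w. measure \<mu> (cylinder (v @ w)) \<le>
      D * (measure \<mu> (cylinder v) * measure \<mu> (cylinder w))"
    and concat_lower: "\<And>v w. measure \<mu> (cylinder v) * measure \<mu> (cylinder w) \<le>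
      D * measure \<mu> (cylinder (v @ w))"
begin

lemma full_shift_event: "full_shift \<in> events"
  using sets.top[of \<mu>] by (simp add: space_eq)

lemma cylinder_event: "cylinder w \<in> events"
proof -
  have "cylinder w = {x \<in> space \<mu>. \<forall>i\<in>{..<length w}. x i \<in> {w ! i}}"
    by (auto simp: cylinder_def space_eq)
  also have "\<dots> \<in> events"
    using coordinate_event[of _ "{_}"] by (intro sets.sets_Collect_finite_All) (auto simp: space_eq)
  finally show ?thesis .
qed

lemma depends_event: assumes "depends n A" shows "A \<in> events"
  by (subst depends_eq_UN_cylinders[OF assms])
    (intro sets.countable_UN'' cylinder_event countableI_type)

lemma prob_at_time: assumes "depends n B" shows "prob (at_time m B) = prob B"
proof (induction m)
  case 0
  then show ?case using assms by (simp add: at_time_0 depends_def)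
next
  case (Suc m)
  have "at_time (Suc m) B = shift -` at_time m B \<inter> space \<mu>"
    using full_shift_funpow[of _ 1] by (auto simp: at_time_def space_eq funpow_swap1)
  moreover have "at_time m B \<in> events"
    by (rule depends_event[OF depends_at_time[OF assms]])
  ultimately have "emeasure \<mu> (at_time (Suc m) B) = emeasure \<mu> (at_time m B)"
    using invariant by (simp add: shift_invariant_def)
  then show ?case using Suc by (simp add: measure_def)
qed

text \<open>There are only countably many words, so events decided by finitely many letters can be split
  into cylinders and summed. This is what transfers the inequalities for words to such events.\<close>

lemma emeasure_at_time_decompose:
  assumes A: "A \<in> events" and B: "depends n B"
  shows "emeasure \<mu> (A \<inter> at_time m B) =
    (\<integral>\<^sup>+w. emeasure \<mu> (A \<inter> at_time m (cylinder w)) \<partial>count_space ((\<lambda>x. map x [0..<n]) ` B))"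
    (is "_ = (\<integral>\<^sup>+w. ?f w \<partial>count_space ?W)")
proof -
  have eq: "A \<inter> at_time m B = (\<Union>w\<in>?W. A \<inter> at_time m (cylinder w))"
    by (subst depends_eq_UN_cylinders[OF B]) (auto simp: at_time_def)
  moreover have "disjoint_family_on (\<lambda>w. A \<inter> at_time m (cylinder w)) ?W"
  proof (unfold disjoint_family_on_def, intro ballI impI)
    fix v w assume "v \<in> ?W" "w \<in> ?W" "v \<noteq> w"
    then have "cylinder v \<inter> cylinder w = {}"
      by (intro disjoint_family_onD[OF cylinders_disjoint[of n]]) auto
    then show "(A \<inter> at_time m (cylinder v)) \<inter> (A \<inter> at_time m (cylinder w)) = {}"
      by (auto simp: at_time_def)
  qed
  moreover have "A \<inter> at_time m (cylinder w) \<in> events" for w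
    using A depends_event[OF depends_at_time[OF depends_cylinder]] by auto
  ultimately show ?thesis
    unfolding eq by (intro emeasure_UN_countable) auto
qed

lemma emeasure_decompose:
  assumes "A \<in> events" "depends n B"
  shows "emeasure \<mu> (A \<inter> B) =
    (\<integral>\<^sup>+w. emeasure \<mu> (A \<inter> cylinder w) \<partial>count_space ((\<lambda>x. map x [0..<n]) ` B))"
  using emeasure_at_time_decompose[OF assms, of 0] assms(2) depends_cylinder
  by (simp add: at_time_0 depends_def)

lemma emeasure_eq_sum_cylinders:
  assumes "depends n B"
  shows "emeasure \<mu> B =
    (\<integral>\<^sup>+w. emeasure \<mu> (cylinder w) \<partial>count_space ((\<lambda>x. map x [0..<n]) ` B))"
proof -
  have "full_shift \<inter> B = B" "\<And>w. full_shift \<inter> cylinder w = cylinder w"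
    using assms by (auto simp: depends_def cylinder_def)
  then show ?thesis using emeasure_decompose[OF full_shift_event assms] by simp
qed

text \<open>The inequality for two words is summed over the words of \<open>B\<close> with \<open>v\<close> fixed, and then over
  the words of \<open>A\<close>.\<close>

lemma prob_joint_upper:
  assumes A: "depends m A" and B: "depends n B"
  shows "prob (A \<inter> at_time m B) \<le> D * (prob A * prob B)"
proof -
  let ?D = "ennreal D" and ?e = "emeasure \<mu>"
  have D: "D \<ge> 0" using D_ge_1 by simp
  have cyl: "?e (cylinder v \<inter> at_time m (cylinder w)) \<le> ?D * ?e (cylinder v) * ?e (cylinder w)"
    if "length v = m" for v w
    using concat_upper[of v w] D that
    by (simp add: cylinder_append emeasure_eq_measure ennreal_mult[symmetric] mult.assoc)
  have half: "?e (at_time m B \<inter> cylinder v) \<le> ?D * ?e B * ?e (cylinder v)" if "length v = m" for v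
  proof -
    have "?e (cylinder v \<inter> at_time m B) \<le>
      (\<integral>\<^sup>+w. ?D * ?e (cylinder v) * ?e (cylinder w) \<partial>count_space ((\<lambda>x. map x [0..<n]) ` B))"
      unfolding emeasure_at_time_decompose[OF cylinder_event B]
      by (intro nn_integral_mono cyl that)
    also have "\<dots> = ?D * ?e (cylinder v) * ?e B"
      by (simp add: nn_integral_cmult emeasure_eq_sum_cylinders[OF B])
    finally show ?thesis by (simp add: ac_simps)
  qed
  have "?e (at_time m B \<inter> A) \<le>
      (\<integral>\<^sup>+v. ?D * ?e B * ?e (cylinder v) \<partial>count_space ((\<lambda>x. map x [0..<m]) ` A))"
    unfolding emeasure_decompose[OF depends_event[OF depends_at_time[OF B]] A]
    by (intro nn_integral_mono half) auto
  also have "\<dots> = ?D * ?e B * ?e A"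
    by (simp add: nn_integral_cmult emeasure_eq_sum_cylinders[OF A])
  finally have "ennreal (prob (A \<inter> at_time m B)) \<le> ennreal (D * (prob A * prob B))"
    using D by (simp add: emeasure_eq_measure ennreal_mult[symmetric] ac_simps)
  then show ?thesis using D by (subst (asm) ennreal_le_iff) auto
qed

lemma prob_joint_lower:
  assumes A: "depends m A" and B: "depends n B"
  shows "prob A * prob B \<le> D * prob (A \<inter> at_time m B)"
proof -
  let ?D = "ennreal D" and ?e = "emeasure \<mu>"
  have D: "D \<ge> 0" using D_ge_1 by simp
  have cyl: "?e (cylinder v) * ?e (cylinder w) \<le> ?D * ?e (cylinder v \<inter> at_time m (cylinder w))"
    if "length v = m" for v w
    using concat_lower[of v w] D that
    by (simp add: cylinder_append emeasure_eq_measure ennreal_mult[symmetric] mult.assoc)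
  have half: "?e B * ?e (cylinder v) \<le> ?D * ?e (at_time m B \<inter> cylinder v)" if "length v = m" for v
  proof -
    have "?e (cylinder v) * ?e B =
      (\<integral>\<^sup>+w. ?e (cylinder v) * ?e (cylinder w) \<partial>count_space ((\<lambda>x. map x [0..<n]) ` B))"
      by (simp add: nn_integral_cmult emeasure_eq_sum_cylinders[OF B])
    also have "\<dots> \<le> (\<integral>\<^sup>+w. ?D * ?e (cylinder v \<inter> at_time m (cylinder w))
        \<partial>count_space ((\<lambda>x. map x [0..<n]) ` B))"
      by (intro nn_integral_mono cyl that)
    also have "\<dots> = ?D * ?e (cylinder v \<inter> at_time m B)"
      by (simp add: nn_integral_cmult emeasure_at_time_decompose[OF cylinder_event B])
    finally show ?thesis by (simp add: ac_simps)
  qed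
  have "?e B * ?e A = (\<integral>\<^sup>+v. ?e B * ?e (cylinder v) \<partial>count_space ((\<lambda>x. map x [0..<m]) ` A))"
    by (simp add: nn_integral_cmult emeasure_eq_sum_cylinders[OF A])
  also have "\<dots> \<le> (\<integral>\<^sup>+v. ?D * ?e (at_time m B \<inter> cylinder v)
      \<partial>count_space ((\<lambda>x. map x [0..<m]) ` A))"
    by (intro nn_integral_mono half) auto
  also have "\<dots> = ?D * ?e (at_time m B \<inter> A)"
    by (simp add: nn_integral_cmult
        emeasure_decompose[OF depends_event[OF depends_at_time[OF B]] A])
  finally have "ennreal (prob A * prob B) \<le> ennreal (D * prob (A \<inter> at_time m B))"
    using D by (simp add: emeasure_eq_measure ennreal_mult[symmetric] ac_simps)
  then show ?thesis using D by (subst (asm) ennreal_le_iff) auto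
qed

text \<open>The lower bound for joint events, read as a statement on the complement: no past \<open>A\<close> can
  make \<open>B\<close> at time \<open>m\<close> much less likely.\<close>

lemma prob_miss:
  assumes A: "depends m A" and B: "depends n B"
  shows "prob (A \<inter> at_time m (full_shift - B)) \<le> (1 - prob B / D) * prob A"
proof -
  have "A \<inter> at_time m (full_shift - B) = A - (A \<inter> at_time m B)"
    using A full_shift_funpow by (auto simp: at_time_def depends_def)
  moreover have "prob (A - (A \<inter> at_time m B)) = prob A - prob (A \<inter> at_time m B)"
    using depends_event[OF A] depends_event[OF depends_at_time[OF B]]
    by (intro finite_measure_Diff) auto
  moreover have "prob A * prob B / D \<le> prob (A \<inter> at_time m B)"
    using prob_joint_lower[OF A B] D_ge_1 by (simp add: divide_le_eq mult.commute)
  ultimately show ?thesis by (simp add: algebra_simps)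
qed

section \<open>Block cylinders and their return times\<close>

text \<open>The rate \<open>\<rho>\<close>: a bound for the conditional probability of obeying one more letter constraint that excludes
  the letter \<open>1\<close> or the letter \<open>2\<close>.\<close>

definition decay :: real where
  "decay = 1 - min (prob (cylinder [1])) (prob (cylinder [2])) / D"

lemma decay_bounds: "0 \<le> decay" "decay < 1"
proof -
  have "min (prob (cylinder [1])) (prob (cylinder [2])) \<le> 1" by (simp add: min_le_iff_disj)
  then show "0 \<le> decay" using D_ge_1 by (simp add: decay_def divide_le_eq)
  have "0 < min (prob (cylinder [1])) (prob (cylinder [2]))"
    using cylinder_pos[of "[1]"] cylinder_pos[of "[2]"] by simp
  then show "decay < 1" using D_ge_1 by (simp add: decay_def)
qed

text \<open>Obeying the constraint on letter \<open>k\<close> entails avoiding one of the events \<open>[1]\<close>, \<open>[2]\<close> at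
  time \<open>k\<close>, whose probability given the past is bounded below.\<close>

lemma prob_block_cylinder_le:
  assumes "\<And>m. m < k \<Longrightarrow> 1 \<notin> V m \<or> 2 \<notin> V m"
  shows "prob (block_cylinder k V) \<le> decay ^ k"
  using assms
proof (induction k)
  case 0
  then show ?case by simp
next
  case (Suc k)
  obtain a where a: "a \<in> {1, 2}" "a \<notin> V k" using Suc.prems[of k] by auto
  have "block_cylinder (Suc k) V \<subseteq> block_cylinder k V \<inter> at_time k (full_shift - cylinder [a])"
    using a full_shift_funpow[of _ k]
    by (force simp: block_cylinder_def at_time_def cylinder_def funpow_shift less_Suc_eq full_shift_def)
  then have "prob (block_cylinder (Suc k) V) \<le> prob (block_cylinder k V \<inter> at_time k (full_shift - cylinder [a]))"
    using depends_event[OF depends_block_cylinder] 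
      depends_event[OF depends_at_time[OF depends_Diff[OF depends_cylinder]]]
    by (intro finite_measure_mono) auto
  also have "\<dots> \<le> (1 - prob (cylinder [a]) / D) * prob (block_cylinder k V)"
    by (rule prob_miss[OF depends_block_cylinder depends_cylinder])
  also have "\<dots> \<le> decay * prob (block_cylinder k V)"
    using a(1) D_ge_1 unfolding decay_def
    by (intro mult_right_mono diff_left_mono divide_right_mono) auto
  also have "\<dots> \<le> decay * decay ^ k"
    using Suc decay_bounds by (intro mult_left_mono) auto
  finally show ?case by simp
qed

text \<open>A return after \<open>g < k\<close> steps overlaps the first visit in \<open>k - g\<close> letters. Dropping the
  constraints on the overlap leaves those on the \<open>g\<close> letters from time \<open>k\<close> on, and these are
  independent of the first visit up to the factor \<open>D\<close>. For \<open>g \<ge> k\<close> there is no overlap. The sum \<open>u + \<rho>\<^sup>g\<close> covers both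
  cases.\<close>

lemma prob_return_le:
  assumes V: "\<And>m. m < k \<Longrightarrow> 1 \<notin> V m \<or> 2 \<notin> V m"
  shows "prob (block_cylinder k V \<inter> at_time g (block_cylinder k V)) \<le>
    D * prob (block_cylinder k V) * (prob (block_cylinder k V) + decay ^ g)"
proof (cases "k \<le> g")
  case True
  have "prob (block_cylinder k V \<inter> at_time g (block_cylinder k V)) \<le> D * (prob (block_cylinder k V) * prob (block_cylinder k V))"
    by (rule prob_joint_upper[OF depends_mono[OF depends_block_cylinder True] depends_block_cylinder])
  also have "\<dots> \<le> D * prob (block_cylinder k V) * (prob (block_cylinder k V) + decay ^ g)"
    using D_ge_1 decay_bounds by (auto simp: algebra_simps)
  finally show ?thesis .
next
  case False
  \<comment> \<open>The constraints of the second visit that lie beyond the first: coordinate \<open>k - g + m\<close> of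
    \<open>\<sigma>\<^sup>g x\<close> is coordinate \<open>m\<close> of \<open>\<sigma>\<^sup>k x\<close>.\<close>
  define V' where "V' m = V (k - g + m)" for m
  have "x \<in> at_time k (block_cylinder g V')" if "x \<in> at_time g (block_cylinder k V)" for x
  proof -
    have "x (k + m) \<in> V (k - g + m)" if "m < g" for m
    proof -
      have "k - g + m < k" using that False by simp
      then have "x (k - g + m + g) \<in> V (k - g + m)"
        using \<open>x \<in> at_time g (block_cylinder k V)\<close> by (auto simp: at_time_def block_cylinder_def funpow_shift)
      moreover have "k - g + m + g = k + m" using False by simp
      ultimately show ?thesis by simp
    qed
    then show ?thesis using that
      by (auto simp: at_time_def block_cylinder_def funpow_shift V'_def full_shift_def ac_simps)
  qed
  then have "prob (block_cylinder k V \<inter> at_time g (block_cylinder k V)) \<le> prob (block_cylinder k V \<inter> at_time k (block_cylinder g V'))"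
    using depends_event[OF depends_block_cylinder] depends_event[OF depends_at_time[OF depends_block_cylinder]]
    by (intro finite_measure_mono) auto
  also have "\<dots> \<le> D * (prob (block_cylinder k V) * prob (block_cylinder g V'))"
    by (rule prob_joint_upper[OF depends_block_cylinder depends_block_cylinder])
  also have "\<dots> \<le> D * (prob (block_cylinder k V) * (prob (block_cylinder k V) + decay ^ g))"
  proof -
    have "prob (block_cylinder g V') \<le> decay ^ g"
      using V False by (intro prob_block_cylinder_le) (auto simp: V'_def)
    then show ?thesis using D_ge_1 by (intro mult_left_mono) (auto intro: add_increasing)
  qed
  finally show ?thesis by (simp add: mult.assoc)
qed

definition hits :: "(nat \<Rightarrow> nat) set \<Rightarrow> nat \<Rightarrow> (nat \<Rightarrow> nat) set" where
  "hits U T = (\<Union>i\<in>{1..T}. at_time i U)"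

lemma depends_hits: "depends k U \<Longrightarrow> depends (T + k) (hits U T)"
  unfolding hits_def
  by (intro depends_UN depends_mono[OF depends_at_time]) auto

text \<open>The constant is the bound \<open>Q\<close> of the second moment method. For a fixed visit at time \<open>i\<close>, the
  pair \<open>(i, i)\<close> contributes \<open>u\<close>, and the earlier and the later times contribute at most
  \<open>D u (T u + \<Sum>\<^sub>g \<rho>\<^sup>g) \<le> u (2 D + D / (1 - \<rho>))\<close> each.\<close>

lemma prob_hits_ge:
  assumes V: "\<And>m. m < k \<Longrightarrow> 1 \<notin> V m \<or> 2 \<notin> V m"
  defines "u \<equiv> prob (block_cylinder k V)"
  assumes T: "real T * u \<le> 2"
  shows "real T * u / (1 + 4 * D + 2 * D / (1 - decay)) \<le> prob (hits (block_cylinder k V) T)"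
proof -
  let ?U = "block_cylinder k V" and ?Q = "1 + 4 * D + 2 * D / (1 - decay)"
  have u: "u \<ge> 0" by (simp add: u_def)
  have Q: "?Q > 0" using D_ge_1 decay_bounds by (intro add_pos_pos) auto
  have ev: "at_time i ?U \<in> events" for i
    by (rule depends_event[OF depends_at_time[OF depends_block_cylinder]])
  have pe: "prob (at_time i ?U) = u" for i
    unfolding u_def by (rule prob_at_time[OF depends_block_cylinder])
  have pair: "prob (at_time i ?U \<inter> at_time j ?U) \<le> D * u * (u + decay ^ (j - i))" if "i < j" for i j
  proof -
    have "at_time i ?U \<inter> at_time j ?U = at_time i (?U \<inter> at_time (j - i) ?U)"
      using that at_time_add[of i "j - i" ?U] by (auto simp: at_time_def)
    moreover have "depends (j - i + k) (?U \<inter> at_time (j - i) ?U)"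
      by (intro depends_Int depends_at_time depends_block_cylinder depends_mono[OF depends_block_cylinder]) auto
    ultimately have "prob (at_time i ?U \<inter> at_time j ?U) = prob (?U \<inter> at_time (j - i) ?U)"
      by (simp add: prob_at_time)
    also have "\<dots> \<le> D * u * (u + decay ^ (j - i))"
      unfolding u_def by (rule prob_return_le[OF V])
    finally show ?thesis .
  qed
  have geom: "(\<Sum>j\<in>J. decay ^ f j) \<le> 1 / (1 - decay)"
    if "inj_on f J" "finite J" for f :: "nat \<Rightarrow> nat" and J
  proof -
    have "(\<Sum>j\<in>J. decay ^ f j) = sum ((^) decay) (f ` J)" using that by (simp add: sum.reindex)
    also have "\<dots> \<le> (\<Sum>n. decay ^ n)"
      using decay_bounds that by (intro sum_le_suminf summable_geometric) auto
    also have "\<dots> = 1 / (1 - decay)" using decay_bounds by (intro suminf_geometric) auto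
    finally show ?thesis .
  qed
  have half: "(\<Sum>j\<in>J. D * u * (u + decay ^ f j)) \<le> D * u * (2 + 1 / (1 - decay))"
    if "inj_on f J" "J \<subseteq> {1..T}" for f :: "nat \<Rightarrow> nat" and J
  proof -
    have fin: "finite J" "card J \<le> T"
      using that(2) finite_subset[of J "{1..T}"] card_mono[of "{1..T}" J] by auto
    have "real (card J) * u \<le> real T * u" using fin u by (intro mult_right_mono) auto
    then have "real (card J) * u + (\<Sum>j\<in>J. decay ^ f j) \<le> 2 + 1 / (1 - decay)"
      using T geom[OF that(1) fin(1)] by linarith
    then have "D * u * (real (card J) * u + (\<Sum>j\<in>J. decay ^ f j)) \<le> D * u * (2 + 1 / (1 - decay))"
      using D_ge_1 u by (intro mult_left_mono) auto
    then show ?thesis by (simp add: sum_distrib_left[symmetric] sum.distrib)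
  qed
  have row: "(\<Sum>j\<in>{1..T}. prob (at_time i ?U \<inter> at_time j ?U)) \<le> ?Q * u" if i: "i \<in> {1..T}" for i
  proof -
    have split: "{1..T} = {1..<i} \<union> ({i} \<union> {i<..T})" using i by auto
    have "(\<Sum>j\<in>{1..T}. prob (at_time i ?U \<inter> at_time j ?U)) =
      (\<Sum>j\<in>{1..<i}. prob (at_time i ?U \<inter> at_time j ?U)) + (u +
      (\<Sum>j\<in>{i<..T}. prob (at_time i ?U \<inter> at_time j ?U)))"
      unfolding split by (subst sum.union_disjoint; auto simp: pe)+
    also have "(\<Sum>j\<in>{1..<i}. prob (at_time i ?U \<inter> at_time j ?U)) \<le>
        (\<Sum>j\<in>{1..<i}. D * u * (u + decay ^ (i - j)))"
      using pair by (intro sum_mono) (auto simp: Int_commute)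
    also have "\<dots> \<le> D * u * (2 + 1 / (1 - decay))"
      using i by (intro half) (auto simp: inj_on_def)
    also have "(\<Sum>j\<in>{i<..T}. prob (at_time i ?U \<inter> at_time j ?U)) \<le>
        (\<Sum>j\<in>{i<..T}. D * u * (u + decay ^ (j - i)))"
      using pair by (intro sum_mono) auto
    also have "\<dots> \<le> D * u * (2 + 1 / (1 - decay))"
      using i by (intro half) (auto simp: inj_on_def)
    finally show ?thesis by (simp add: algebra_simps)
  qed
  have "(\<Sum>i\<in>{1..T}. \<Sum>j\<in>{1..T}. prob (at_time i ?U \<inter> at_time j ?U)) \<le> (\<Sum>i\<in>{1..T}. ?Q * u)"
    by (intro sum_mono row)
  then have "(\<Sum>i\<in>{1..T}. prob (at_time i ?U)) / ?Q \<le> prob (\<Union>i\<in>{1..T}. at_time i ?U)"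
    using Q ev by (intro second_moment_bound) (auto simp: pe mult_ac)
  then show ?thesis by (simp add: pe hits_def)
qed

text \<open>A visit during \<open>{1..T}\<close> is decided by \<open>T + k\<close> letters. With blocks of \<open>L \<ge> T + k\<close> letters
  the windows do not interfere, so each block contributes one factor of \<open>prob_miss\<close>.\<close>

lemma prob_no_hits_le:
  assumes U: "depends k U" and L: "T + k \<le> L"
  shows "prob (full_shift - hits U (n * L)) \<le> (1 - prob (hits U T) / D) ^ n"
proof -
  define r where "r = 1 - prob (hits U T) / D"
  \<comment> \<open>no visit in the first \<open>n\<close> windows; window \<open>j\<close> consists of the times \<open>jL + 1, \<dots>, jL + T\<close>\<close>
  define G where "G n = {x \<in> full_shift. \<forall>j<n. (shift ^^ (j * L)) x \<notin> hits U T}" for n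
  have H: "depends L (hits U T)" by (rule depends_mono[OF depends_hits[OF U] L])
  have GS: "G (Suc n) = G n \<inter> at_time (n * L) (full_shift - hits U T)" for n
    using full_shift_funpow by (auto simp: G_def at_time_def less_Suc_eq)
  have G: "depends (n * L) (G n)" for n
  proof (induction n)
    case 0
    then show ?case by (simp add: G_def depends_full_shift)
  next
    case (Suc n)
    have "depends (n * L + L) (G (Suc n))"
      unfolding GS by (intro depends_Int depends_at_time depends_Diff H depends_mono[OF Suc]) auto
    then show ?case by (simp add: add.commute)
  qed
  have "prob (hits U T) \<le> D" using D_ge_1 prob_le_1[of "hits U T"] by linarith
  then have "prob (hits U T) / D \<le> 1" using D_ge_1 by simp
  then have r: "0 \<le> r" by (simp add: r_def)
  have GP: "prob (G n) \<le> r ^ n" for n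
  proof (induction n)
    case 0
    then show ?case by simp
  next
    case (Suc n)
    have "prob (G (Suc n)) \<le> r * prob (G n)"
      unfolding GS r_def by (rule prob_miss[OF G H])
    also have "\<dots> \<le> r * r ^ n" using Suc r by (intro mult_left_mono)
    finally show ?case by simp
  qed
  have "full_shift - hits U (n * L) \<subseteq> G n"
  proof
    fix x assume x: "x \<in> full_shift - hits U (n * L)"
    have "(shift ^^ (j * L)) x \<notin> hits U T" if j: "j < n" for j
    proof
      assume "(shift ^^ (j * L)) x \<in> hits U T"
      then obtain i where i: "1 \<le> i" "i \<le> T" "(shift ^^ (i + j * L)) x \<in> U"
        by (auto simp: hits_def at_time_def funpow_add)
      have "i + j * L \<le> Suc j * L" using i(2) L by simp
      also have "\<dots> \<le> n * L" using j by (intro mult_right_mono) auto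
      finally have "x \<in> hits U (n * L)"
        using x i unfolding hits_def at_time_def by (intro UN_I[of "i + j * L"]) auto
      then show False using x by simp
    qed
    then show "x \<in> G n" using x by (simp add: G_def)
  qed
  then have "prob (full_shift - hits U (n * L)) \<le> prob (G n)"
    using depends_event[OF G] by (intro finite_measure_mono)
  then show ?thesis using GP[of n] by (simp add: r_def)
qed

section \<open>The expected hitting time\<close>

text \<open>The tail sum formula; the work lies in measurability, which holds because every tail event
  is decided by finitely many letters.\<close>

lemma expected_hitting_time_eq:
  assumes U: "depends k U"
  shows "expected_hitting_time \<mu> U = (\<Sum>n. ennreal (prob (full_shift - hits U n)))"
proof -
  have tail: "{x \<in> space \<mu>. enat n < hitting_time U x} = full_shift - hits U n" for n
    using hitting_time_le_iff[of U _ n]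
    by (auto simp: space_eq hits_def at_time_def not_le[symmetric])
  have tail_event: "{x \<in> space \<mu>. enat n < hitting_time U x} \<in> events" for n
    unfolding tail by (rule depends_event[OF depends_Diff[OF depends_hits[OF U]]])
  have "hitting_time U \<in> measurable \<mu> (count_space UNIV)"
  proof (rule measurable_count_space_eq2_countable[THEN iffD2], intro conjI ballI)
    fix a :: enat
    have le: "{x \<in> space \<mu>. hitting_time U x \<le> enat n} \<in> events" for n
      using sets.compl_sets[OF tail_event[of n]]
      by (rule back_subst[where P = "\<lambda>S. S \<in> events"]) (auto simp: not_less)
    show "hitting_time U -` {a} \<inter> space \<mu> \<in> events"
    proof (cases a)
      case (enat n)
      have "hitting_time U -` {a} \<inter> space \<mu> = {x \<in> space \<mu>. hitting_time U x \<le> enat n} -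
          (\<Union>m\<in>{..<n}. {x \<in> space \<mu>. hitting_time U x \<le> enat m})"
      proof -
        have "t = enat n \<longleftrightarrow> t \<le> enat n \<and> (\<forall>m<n. \<not> t \<le> enat m)" for t
          by (cases t) (auto, meson le_neq_implies_less order_refl)
        then show ?thesis by (auto simp: enat)
      qed
      then show ?thesis using le by auto
    next
      case infinity
      have "hitting_time U -` {a} \<inter> space \<mu> =
          space \<mu> - (\<Union>m. {x \<in> space \<mu>. hitting_time U x \<le> enat m})"
      proof -
        have "t = \<infinity> \<longleftrightarrow> (\<forall>m. \<not> t \<le> enat m)" for t by (cases t) auto
        then show ?thesis by (auto simp: infinity)
      qed
      then show ?thesis using le by auto
    qed
  qed auto
  then show ?thesis
    unfolding expected_hitting_time_def
    by (subst nn_integral_enat_function) (auto simp: tail emeasure_eq_measure)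
qed

text \<open>By the union bound \<open>U\<close> is hit by time \<open>n\<close> with probability at most \<open>n u\<close>, so about
  \<open>1 / (2u)\<close> terms of the tail sum are at least \<open>1/2\<close>.\<close>

lemma expected_hitting_time_lower:
  assumes U: "depends k U" and pos: "prob U > 0"
  shows "ennreal (1 / 4) / emeasure \<mu> U \<le> expected_hitting_time \<mu> U"
proof -
  define M where "M = nat \<lceil>1 / (2 * prob U)\<rceil>"
  have half: "1 / 2 \<le> prob (full_shift - hits U n)" if n: "n < M" for n
  proof -
    have "prob (hits U n) \<le> (\<Sum>i\<in>{1..n}. prob (at_time i U))"
      unfolding hits_def using depends_event[OF depends_at_time[OF U]]
      by (intro finite_measure_subadditive_finite) auto
    also have "\<dots> = real n * prob U" by (simp add: prob_at_time[OF U])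
    also have "\<dots> \<le> 1 / 2"
    proof -
      have "real n < 1 / (2 * prob U)" using n unfolding M_def by linarith
      then show ?thesis using pos by (simp add: field_simps)
    qed
    finally show ?thesis
      using prob_compl[OF depends_event[OF depends_hits[OF U]], of n] by (simp add: space_eq)
  qed
  have "1 / (2 * prob U) \<le> real M" unfolding M_def by linarith
  then have "1 / 4 / prob U \<le> (\<Sum>n<M. 1 / 2 :: real)" using pos by (simp add: field_simps)
  also have "\<dots> \<le> (\<Sum>n<M. prob (full_shift - hits U n))" by (intro sum_mono half) auto
  finally have "ennreal (1 / 4 / prob U) \<le> (\<Sum>n<M. ennreal (prob (full_shift - hits U n)))"
    by (simp add: sum_ennreal ennreal_leI)
  also have "\<dots> \<le> (\<Sum>n. ennreal (prob (full_shift - hits U n)))"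
    by (intro sum_le_suminf) auto
  finally show ?thesis
    using pos by (simp add: expected_hitting_time_eq[OF U] emeasure_eq_measure divide_ennreal)
qed

text \<open>The tail sum, grouped into blocks of length \<open>L\<close>, is dominated by \<open>L\<close> times a geometric series
  with ratio at most \<open>1 - p / D\<close>.\<close>

lemma expected_hitting_time_le:
  assumes U: "depends k U" and L: "T + k \<le> L" "0 < L" and p: "0 < p" "p \<le> prob (hits U T)"
  shows "expected_hitting_time \<mu> U \<le> ennreal (real L * D / p)"
proof -
  define a where "a n = prob (full_shift - hits U n)" for n
  define r where "r = 1 - prob (hits U T) / D"
  have "prob (hits U T) \<le> D" using D_ge_1 prob_le_1[of "hits U T"] by linarith
  then have "prob (hits U T) / D \<le> 1" "0 < prob (hits U T) / D" using D_ge_1 p by simp_all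
  then have r: "0 \<le> r" "r < 1" by (auto simp: r_def)
  have a_mono: "a n \<le> a m" if "m \<le> n" for m n
    unfolding a_def using that depends_event[OF depends_Diff[OF depends_hits[OF U]]]
    by (intro finite_measure_mono) (auto simp: hits_def)
  have aL: "a (n * L) \<le> r ^ n" for n
    unfolding a_def r_def by (rule prob_no_hits_le[OF U L(1)])
  have partial: "(\<Sum>n<N. a n) \<le> real L * D / p" for N
  proof -
    have "N \<le> N * L" using L(2) by simp
    then have "(\<Sum>n<N. a n) \<le> (\<Sum>n<N * L. a n)"
      by (intro sum_mono2) (auto simp: a_def)
    also have "\<dots> = (\<Sum>m<N. \<Sum>n\<in>{m * L..<m * L + L}. a n)" by (simp add: sum.nat_group)
    also have "\<dots> \<le> (\<Sum>m<N. \<Sum>n\<in>{m * L..<m * L + L}. r ^ m)"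
      by (intro sum_mono order.trans[OF a_mono aL]) auto
    also have "\<dots> = real L * (\<Sum>m<N. r ^ m)" by (simp add: sum_distrib_left)
    also have "\<dots> \<le> real L * (\<Sum>m. r ^ m)"
      using r by (intro mult_left_mono sum_le_suminf summable_geometric) auto
    also have "\<dots> = real L * (D / prob (hits U T))"
      using r by (subst suminf_geometric) (auto simp: r_def)
    also have "\<dots> \<le> real L * (D / p)"
      using p D_ge_1 by (intro mult_left_mono divide_left_mono) auto
    finally show ?thesis by simp
  qed
  have "(\<Sum>n. ennreal (a n)) \<le> ennreal (real L * D / p)"
    using partial by (intro suminf_le_const summableI) (auto simp: sum_ennreal a_def ennreal_leI)
  then show ?thesis by (simp add: expected_hitting_time_eq[OF U] a_def)
qed

text \<open>The window \<open>T = \<lceil>1/u\<rceil>\<close> satisfies \<open>1 \<le> T u \<le> 2\<close>. The letters beyond the window are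
  harmless because \<open>k u \<le> \<Sum>\<^sub>i\<^sub><\<^sub>k \<rho>\<^sup>i \<le> 1 / (1 - \<rho>)\<close>.\<close>

theorem expected_hitting_time_block_cylinder_upper:
  assumes V: "\<And>m. m < k \<Longrightarrow> 1 \<notin> V m \<or> 2 \<notin> V m" and pos: "prob (block_cylinder k V) > 0"
  shows "expected_hitting_time \<mu> (block_cylinder k V) \<le>
    ennreal ((2 + 1 / (1 - decay)) * D * (1 + 4 * D + 2 * D / (1 - decay))) / emeasure \<mu> (block_cylinder k V)"
proof -
  define u where "u = prob (block_cylinder k V)"
  define Q where "Q = 1 + 4 * D + 2 * D / (1 - decay)"
  define T where "T = nat \<lceil>1 / u\<rceil>"
  have u: "0 < u" "u \<le> 1" using pos by (auto simp: u_def)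
  have Q: "Q > 0" unfolding Q_def using D_ge_1 decay_bounds by (intro add_pos_pos) auto
  have "0 < 1 / u" using u by simp
  then have "1 / u \<le> real T" "real T \<le> 1 / u + 1" "T > 0" unfolding T_def by linarith+
  then have T: "1 \<le> real T * u" "real T * u \<le> 2" using u by (auto simp: field_simps)
  have "1 / Q \<le> real T * u / Q" using T(1) Q by (intro divide_right_mono) auto
  also have "\<dots> \<le> prob (hits (block_cylinder k V) T)"
    unfolding Q_def u_def by (rule prob_hits_ge[OF V]) (use T u_def in auto)
  finally have "expected_hitting_time \<mu> (block_cylinder k V) \<le> ennreal (real (T + k) * D / (1 / Q))"
    using Q \<open>T > 0\<close> by (intro expected_hitting_time_le[OF depends_block_cylinder]) auto
  also have "\<dots> \<le> ennreal ((2 + 1 / (1 - decay)) * D * Q / u)"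
  proof (intro ennreal_leI)
    have "real k * u \<le> (\<Sum>i<k. decay ^ i)"
    proof -
      have "u \<le> decay ^ i" if "i < k" for i
        using prob_block_cylinder_le[OF V] power_decreasing[of i k decay] that decay_bounds
        unfolding u_def by force
      then show ?thesis using sum_mono[of "{..<k}" "\<lambda>_. u" "\<lambda>i. decay ^ i"] by simp
    qed
    also have "\<dots> \<le> (\<Sum>i. decay ^ i)"
      using decay_bounds by (intro sum_le_suminf summable_geometric) auto
    also have "\<dots> = 1 / (1 - decay)" using decay_bounds by (intro suminf_geometric) auto
    finally have "real (T + k) * u \<le> 2 + 1 / (1 - decay)" using T by (simp add: algebra_simps)
    then have "real (T + k) * u * (D * Q) \<le> (2 + 1 / (1 - decay)) * (D * Q)"
      using D_ge_1 Q by (intro mult_right_mono) auto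
    then show "real (T + k) * D / (1 / Q) \<le> (2 + 1 / (1 - decay)) * D * Q / u"
      using u by (simp add: pos_le_divide_eq mult_ac)
  qed
  also have "\<dots> = ennreal ((2 + 1 / (1 - decay)) * D * Q) / emeasure \<mu> (block_cylinder k V)"
    using u Q D_ge_1 decay_bounds
    by (subst emeasure_eq_measure, subst divide_ennreal) (auto simp: u_def intro!: add_nonneg_nonneg)
  finally show ?thesis by (simp add: Q_def)
qed

end

section \<open>Gibbs measures are quasi-Bernoulli\<close>

text \<open>Birkhoff sums are additive along the orbit, so the weight \<open>exp (S\<^sub>n \<phi> - n P)\<close> of a point of
  \<open>[vw]\<close> is the product of a weight of \<open>[v]\<close> and one of \<open>[w]\<close>. The three comparisons with
  \<open>\<mu>[vw]\<close>, \<open>\<mu>[v]\<close> and \<open>\<mu>[w]\<close> cost a factor \<open>K\<close> each, whence the constant \<open>K\<^sup>3\<close>.\<close>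

lemma gibbs_measure_imp_quasi_bernoulli:
  assumes \<theta>: "0 < \<theta>" "\<theta> < 1" and gibbs: "gibbs_measure \<theta> \<phi> \<mu>"
  shows "\<exists>D. quasi_bernoulli \<mu> D"
proof -
  interpret prob_space \<mu> using gibbs by (simp add: gibbs_measure_def)
  interpret X: Metric_space full_shift "d1 \<theta>" by (rule Metric_space_d1[OF \<theta>])
  let ?\<O> = "{U. openin X.mtopology U}"
  have open_sub: "?\<O> \<subseteq> Pow full_shift" using openin_subset by fastforce
  have sets: "sets \<mu> = sets (shift_borel \<theta>)" using gibbs by (simp add: gibbs_measure_def)
  have space: "space \<mu> = full_shift"
    using sets_eq_imp_space_eq[OF sets] open_sub by (simp add: shift_borel_def space_measure_of)
  have coord: "{x \<in> full_shift. x i \<in> V} \<in> sets \<mu>" for i V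
    using openin_coord[OF \<theta>, of i V] open_sub
    by (simp add: sets shift_borel_def sets_measure_of)
  obtain K P where K: "K > 1" and KP: "\<And>ys x. length ys \<ge> 1 \<Longrightarrow> set ys \<subseteq> {1..} \<Longrightarrow> x \<in> cylinder ys \<Longrightarrow>
      1 / K \<le> prob (cylinder ys) / exp (birkhoff_sum \<phi> (length ys) x - real (length ys) * P) \<and>
      prob (cylinder ys) / exp (birkhoff_sum \<phi> (length ys) x - real (length ys) * P) \<le> K"
    using gibbs unfolding gibbs_measure_def by metis
  define E where "E n x = exp (birkhoff_sum \<phi> n x - real n * P)" for n x
  have E_pos: "E n x > 0" for n x by (simp add: E_def)
  have KE: "E (length ys) x \<le> K * prob (cylinder ys)" "prob (cylinder ys) \<le> K * E (length ys) x"
    if "ys \<noteq> []" "set ys \<subseteq> {1..}" "x \<in> cylinder ys" for ys x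
    using KP[of ys x] that K E_pos[of "length ys" x] unfolding E_def[symmetric]
    by (auto simp: field_simps Suc_le_eq)
  have E_add: "E (m + n) x = E m x * E n ((shift ^^ m) x)" for m n x
  proof -
    have "birkhoff_sum \<phi> (m + n) x = birkhoff_sum \<phi> m x + birkhoff_sum \<phi> n ((shift ^^ m) x)"
      by (induction n) (auto simp: birkhoff_sum_def funpow_add[symmetric] add.commute
          simp flip: comp_apply[of "shift ^^ _" "shift ^^ _"])
    then show ?thesis by (simp add: E_def exp_add[symmetric] algebra_simps)
  qed
  have Nil: "prob (cylinder []) = 1" using prob_space by (simp add: cylinder_def space)
  have point: "\<exists>x. x \<in> cylinder w" if "set w \<subseteq> {1..}" for w
  proof
    show "(\<lambda>i. if i < length w then w ! i else 1) \<in> cylinder w"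
      using that by (auto simp: cylinder_def full_shift_def subset_iff)
  qed
  have "set w \<subseteq> {1..}" if "x \<in> cylinder w" for x w
    using that by (auto simp: cylinder_def full_shift_def in_set_conv_nth) (metis Suc_le_eq)
  then have empty: "cylinder w = {}" if "\<not> set w \<subseteq> {1..}" for w
    using that by blast
  have pos: "prob (cylinder w) > 0" if w: "set w \<subseteq> {1..}" for w
  proof (cases "w = []")
    case False
    obtain x where "x \<in> cylinder w" using point[OF w] by blast
    then have "0 < K * prob (cylinder w)"
      using KE(1)[OF False w] E_pos less_le_trans by blast
    then show ?thesis using K by (simp add: zero_less_mult_iff)
  qed (simp add: Nil)
  have K3: "1 \<le> K ^ 3" using K by simp
  have concat: "prob (cylinder (v @ w)) \<le> K ^ 3 * (prob (cylinder v) * prob (cylinder w)) \<and>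
      prob (cylinder v) * prob (cylinder w) \<le> K ^ 3 * prob (cylinder (v @ w))" for v w
  proof (cases "v = [] \<or> w = [] \<or> \<not> set (v @ w) \<subseteq> {1..}")
    case True
    then consider "v = [] \<or> w = []" | "\<not> set (v @ w) \<subseteq> {1..}" by blast
    then show ?thesis
    proof cases
      case 1
      have "p \<le> K ^ 3 * p" if "p \<ge> 0" for p using mult_right_mono[OF K3 that] by simp
      then show ?thesis using 1 by (auto simp: Nil)
    next
      case 2
      have "cylinder v = {} \<or> cylinder w = {}" "cylinder (v @ w) = {}"
        using 2 empty by (metis set_append Un_least)+
      then show ?thesis by auto
    qed
  next
    case False
    then have vw: "v \<noteq> []" "w \<noteq> []" "set v \<subseteq> {1..}" "set w \<subseteq> {1..}" "set (v @ w) \<subseteq> {1..}" by auto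
    obtain x where x: "x \<in> cylinder (v @ w)" using point vw by blast
    then have xv: "x \<in> cylinder v" and xw: "(shift ^^ length v) x \<in> cylinder w"
      by (auto simp: cylinder_append at_time_def)
    note ev = KE[OF vw(1,3) xv] and ew = KE[OF vw(2,4) xw]
    note evw = KE[OF _ vw(5) x, simplified E_add length_append]
    let ?a = "E (length v) x" and ?b = "E (length w) ((shift ^^ length v) x)"
    have "prob (cylinder (v @ w)) \<le> K * (?a * ?b)" using evw(2) vw by simp
    also have "\<dots> \<le> K * ((K * prob (cylinder v)) * (K * prob (cylinder w)))"
      using ev ew K E_pos less_imp_le[OF E_pos] by (intro mult_left_mono mult_mono) auto
    finally have 1: "prob (cylinder (v @ w)) \<le> K ^ 3 * (prob (cylinder v) * prob (cylinder w))"
      by (simp add: power3_eq_cube mult_ac)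
    have "prob (cylinder v) * prob (cylinder w) \<le> (K * ?a) * (K * ?b)"
      using ev ew K less_imp_le[OF E_pos] by (intro mult_mono) auto
    also have "\<dots> = K * K * (?a * ?b)" by simp
    also have "\<dots> \<le> K * K * (K * prob (cylinder (v @ w)))"
      using evw(1) vw K by (intro mult_left_mono) auto
    finally show ?thesis using 1 by (simp add: power3_eq_cube mult_ac)
  qed
  have "quasi_bernoulli \<mu> (K ^ 3)"
    using gibbs space coord pos concat K3
    by unfold_locales (auto simp: gibbs_measure_def)
  then show ?thesis by blast
qed

section \<open>The elements of the cover\<close>

text \<open>\<open>\<delta> < 1\<close> gives \<open>N \<ge> 2\<close> and \<open>(1 + \<surd>(1 + 4/\<delta>)) / 2 \<ge> 1\<close>.\<close>

lemma cover_Ns_pos: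
  assumes "0 < \<delta>" "\<delta> < 1" shows "1 \<le> cover_Ns \<delta>"
proof -
  have "1 \<le> sqrt (1 + 4 / \<delta>)" using assms by simp
  then have "1 \<le> \<lfloor>(1 + sqrt (1 + 4 / \<delta>)) / 2\<rfloor>" by (simp add: le_floor_iff)
  then have "1 \<le> nat \<lfloor>(1 + sqrt (1 + 4 / \<delta>)) / 2\<rfloor>" by (simp only: le_nat_iff)
  moreover have "1 \<le> cover_N \<delta> - 1" using cover_N_ge_2(1)[OF assms] by linarith
  ultimately show ?thesis unfolding cover_Ns_def by (intro min.boundedI)
qed

text \<open>\<open>{1}\<close> is an element of the partition, so it is disjoint from every other one.\<close>

lemma alphabet_partition_misses:
  assumes \<delta>: "0 < \<delta>" "\<delta> < 1" and A: "A \<in> alphabet_partition \<delta>"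
  shows "1 \<notin> A \<or> 2 \<notin> A"
proof (cases "A = {1}")
  case False
  have "{1} \<in> alphabet_partition \<delta>"
    using cover_Ns_pos[OF \<delta>] unfolding alphabet_partition_def by blast
  then have "A \<inter> {1} = {}"
    using alphabet_partition_disjoint[of \<delta>] A False by (auto simp: disjoint_def)
  then show ?thesis by simp
qed simp

lemma alphabet_partition_nonempty: "A \<in> alphabet_partition \<delta> \<Longrightarrow> A \<noteq> {}"
  by (auto simp: alphabet_partition_def)

text \<open>Besides being a block cylinder of the required kind, \<open>U\<close> contains a cylinder, which will
  make its measure positive.\<close>

lemma shift_coverE:
  assumes \<delta>: "0 < \<delta>" "\<delta> < 1" and U: "U \<in> shift_cover \<theta> \<delta>"
  obtains V w where "U = block_cylinder (cover_k \<theta> \<delta>) V" "\<And>m. m < cover_k \<theta> \<delta> \<Longrightarrow> 1 \<notin> V m \<or> 2 \<notin> V m"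
    "set w \<subseteq> {1..}" "cylinder w \<subseteq> U"
proof -
  let ?k = "cover_k \<theta> \<delta>"
  obtain Vs where Vs: "length Vs = ?k" "set Vs \<subseteq> alphabet_partition \<delta>"
    and UV: "U = block_cylinder ?k (\<lambda>m. Vs ! m)"
    using U by (auto simp: shift_cover_def block_cylinder_def)
  have mem: "Vs ! m \<in> alphabet_partition \<delta>" if "m < ?k" for m
    using Vs that by (metis nth_mem subsetD)
  then have "\<forall>m. \<exists>a. m < ?k \<longrightarrow> a \<in> Vs ! m" using alphabet_partition_nonempty by blast
  then obtain f where f: "\<And>m. m < ?k \<Longrightarrow> f m \<in> Vs ! m" by metis
  have "f m \<in> {1..}" if "m < ?k" for m
    using f[OF that] mem[OF that] alphabet_partition_Union[OF \<delta>] by blast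
  then have "set (map f [0..<?k]) \<subseteq> {1..}" by auto
  moreover have "cylinder (map f [0..<?k]) \<subseteq> U"
    using f by (auto simp: UV cylinder_def block_cylinder_def)
  ultimately show ?thesis
    using that[of "\<lambda>m. Vs ! m"] UV mem alphabet_partition_misses[OF \<delta>] by blast
qed

section \<open>Uniform hitting time bounds for the cover\<close>

theorem theorem4p4:
  fixes \<theta> \<kappa> :: real and \<phi> :: "(nat \<Rightarrow> nat) \<Rightarrow> real" and \<mu> :: "(nat \<Rightarrow> nat) measure"
  assumes "0 < \<theta>" and "\<theta> < 1"
    and "\<kappa> > 1"
    and "\<And>n x. n \<ge> 1 \<Longrightarrow> x \<in> cylinder [n] \<Longrightarrow> \<phi> x \<le> - \<kappa> * ln (real n + 1)"
    and "gibbs_measure \<theta> \<phi> \<mu>"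
  shows "\<exists>c C :: real. 0 < c \<and> c < 1 \<and> 1 < C \<and>
    (\<forall>\<delta>. 0 < \<delta> \<and> \<delta> < 1 \<longrightarrow>
      (\<forall>U \<in> shift_cover \<theta> \<delta>.
         ennreal c / emeasure \<mu> U \<le> expected_hitting_time \<mu> U \<and>
         expected_hitting_time \<mu> U \<le> ennreal C / emeasure \<mu> U))"
proof -
  obtain D where "quasi_bernoulli \<mu> D"
    using gibbs_measure_imp_quasi_bernoulli assms(1,2,5) by blast
  then interpret quasi_bernoulli \<mu> D .
  define C where "C = (2 + 1 / (1 - decay)) * D * (1 + 4 * D + 2 * D / (1 - decay))"
  have "2 * 1 \<le> (2 + 1 / (1 - decay)) * D"
    using D_ge_1 decay_bounds by (intro mult_mono) auto
  moreover have "1 \<le> 1 + 4 * D + 2 * D / (1 - decay)"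
    using D_ge_1 decay_bounds by (simp add: add_nonneg_nonneg)
  ultimately have "(2 * 1) * 1 \<le> C"
    unfolding C_def by (rule mult_mono) (use \<open>2 * 1 \<le> _\<close> in linarith, simp)
  then have "1 < C" by simp
  moreover have "ennreal (1 / 4) / emeasure \<mu> U \<le> expected_hitting_time \<mu> U \<and>
      expected_hitting_time \<mu> U \<le> ennreal C / emeasure \<mu> U"
    if \<delta>: "0 < \<delta>" "\<delta> < 1" and U: "U \<in> shift_cover \<theta> \<delta>" for \<delta> U
  proof -
    obtain V w where V: "U = block_cylinder (cover_k \<theta> \<delta>) V"
        "\<And>m. m < cover_k \<theta> \<delta> \<Longrightarrow> 1 \<notin> V m \<or> 2 \<notin> V m"
      and w: "set w \<subseteq> {1..}" "cylinder w \<subseteq> U"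
      by (rule shift_coverE[OF \<delta> U]) (rule that)
    have "prob (cylinder w) \<le> prob U"
      using w(2) depends_event[OF depends_block_cylinder] by (intro finite_measure_mono) (auto simp: V(1))
    then have pos: "prob U > 0" using cylinder_pos[OF w(1)] by linarith
    show ?thesis
      using expected_hitting_time_lower[OF depends_block_cylinder pos[unfolded V(1)]]
        expected_hitting_time_block_cylinder_upper[OF V(2) pos[unfolded V(1)]]
      by (simp add: V(1) C_def)
  qed
  ultimately show ?thesis
    by (intro exI[of _ "1 / 4"] exI[of _ C]) auto
qed

end
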